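(* Let $A\in\mathcal{M}_n(\mathbb{C})$ be diagonalizable, let $E\in\mathcal{M}_n(\mathbb{R})$ be fixed, and let $\upsilon_j$ and $\omega_j$ be the right and left eigenvectors of $A$ corresponding to $\lambda_j\in\sigma(A)$. For small real parameters $\alpha,\beta$ put $\mathcal{L}(E,\alpha,\beta)=\alpha H_E+\beta S_E$ and $M_{\alpha,\beta}=A+\mathcal{L}(E,\alpha,\beta)$, and let $(\lambda_{\alpha,\beta},\upsilon_{\alpha,\beta})$ be the eigenpair of $M_{\alpha,\beta}$ which at $\alpha=\beta=0$ equals $(\lambda_i,\upsilon_i)$. If the eigenpair $(\lambda_{\alpha,\beta},\upsilon_{\alpha,\beta})$ has continuous second order partial derivatives (with respect to $\alpha,\beta$) in the neighborhood of $\lambda_i$ and $\upsilon_i$, then, writing $\mathcal{L}=\mathcal{L}(E,\alpha,\beta)$ and $s_\ell=\omega_\ell^*\upsilon_\ell$, $$\lambda_{\alpha,\beta}=\lambda_i+\frac{\omega_i^*\mathcal{L}\upsilon_i}{s_i}+\sum_{k\neq i}\frac{(\omega_i^*\mathcal{L}\upsilon_k)(\omega_k^*\mathcal{L}\upsilon_i)}{(\lambda_i-\lambda_k)s_is_k}+\mathcal{O}(\alpha^3,\beta^3),$$ $$\upsilon_{\alpha,\beta}=\upsilon_i+\sum_{k\neq i}\frac{\upsilon_k\,\omega_k^*\mathcal{L}\upsilon_i}{(\lambda_i-\lambda_k)s_k}+\sum_{j\neq i}\sum_{k\neq i}\frac{(\omega_j^*\mathcal{L}\upsilon_k)(\omega_k^*\mathcal{L}\upsilon_i)}{(\lambda_i-\lambda_k)(\lambda_i-\lambda_j)s_ks_j}\,\upsilon_j-\sum_{j\neq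 i}\frac{(\omega_j^*\mathcal{L}\upsilon_i)(\omega_i^*\mathcal{L}\upsilon_i)}{(\lambda_i-\lambda_j)^2s_is_j}\,\upsilon_j+\mathcal{O}(\alpha^3,\beta^3).$$
   Context: $\mathcal{M}_n(\mathbb{C})$, $\mathcal{M}_n(\mathbb{R})$ are the algebras of $n\times n$ complex, real matrices; $\sigma(A)$ is the spectrum. $H_E=\frac{E+E^*}{2}$ and $S_E=\frac{E-E^*}{2}$ are the Hermitian and skew-Hermitian parts of $E$. Right and left eigenvectors: $A\upsilon_j=\lambda_j\upsilon_j$, $\omega_j^*A=\lambda_j\omega_j^*$; the $\upsilon_j$ form a basis of $\mathbb{C}^n$, and $\omega_j^*\upsilon_k=0$ for $j\neq k$. Let $\omega_{\alpha,\beta}$ be the left eigenvector of $M_{\alpha,\beta}$ for $\lambda_{\alpha,\beta}$; thus $(M_{\alpha,\beta}-\lambda_{\alpha,\beta}I)\upsilon_{\alpha,\beta}=0$ and $\omega_{\alpha,\beta}^*(M_{\alpha,\beta}-\lambda_{\alpha,\beta}I)=0$. The functions $\lambda_{\alpha,\beta},\upsilon_{\alpha,\beta},\omega_{\alpha,\beta}$ are continuous, with values $\lambda_i,\upsilon_i,\omega_i$ at $\alpha=\beta=0$. Sums over $k\neq i$ (or $j\neq i$) run over the indices whose eigenvalue differs from $\lambda_i$. $\mathcal{O}(\alpha^3,\beta^3)$ denotes a remainder of third order in $\alpha,\beta$.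
   Formalization: The eigenvector expansion is proved under the added normalization ω_j^*υ_{α,β} = ω_j^*υ_i near 0 for all j with λ_j = λ_i; without it the expansion fails, e.g. E = 0 and υ_{α,β} = (1+α)υ_i. *)

theory Defs
  imports "HOL-Analysis.Analysis" "HOL-Library.Landau_Symbols"
begin

definition cnj_vec :: "complex^'n \<Rightarrow> complex^'n" where
  "cnj_vec w = (\<chi> k. cnj (w $ k))"

definition conj_transpose :: "complex^'n^'m \<Rightarrow> complex^'m^'n" where
  "conj_transpose A = (\<chi> i j. cnj (A $ j $ i))"

(* w^* v: conjugate-linear in the first argument. *)
definition herm_prod :: "complex^'n \<Rightarrow> complex^'n \<Rightarrow> complex" where
  "herm_prod w v = (\<Sum>k\<in>UNIV. cnj (w $ k) * v $ k)"

definition complex_mat :: "real^'n^'m \<Rightarrow> complex^'n^'m" where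
  "complex_mat E = (\<chi> i j. complex_of_real (E $ i $ j))"

definition herm_part :: "complex^'n^'n \<Rightarrow> complex^'n^'n" where
  "herm_part E = (1/2) *\<^sub>R (E + conj_transpose E)"

definition skew_part :: "complex^'n^'n \<Rightarrow> complex^'n^'n" where
  "skew_part E = (1/2) *\<^sub>R (E - conj_transpose E)"

definition pert :: "real^'n^'n \<Rightarrow> real \<Rightarrow> real \<Rightarrow> complex^'n^'n" where
  "pert E \<alpha> \<beta> = \<alpha> *\<^sub>R herm_part (complex_mat E) + \<beta> *\<^sub>R skew_part (complex_mat E)"

definition diagonalizable :: "complex^'n^'n \<Rightarrow> bool" where
  "diagonalizable A \<longleftrightarrow>
     (\<exists>(P :: complex^'n^'n) (D :: complex^'n^'n).
        invertible P \<and> (\<forall>i j. i \<noteq> j \<longrightarrow> D $ i $ j = 0) \<and> A = P ** D ** matrix_inv P)"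

definition right_eigenvector :: "complex^'n^'n \<Rightarrow> complex \<Rightarrow> complex^'n \<Rightarrow> bool" where
  "right_eigenvector A c v \<longleftrightarrow> v \<noteq> 0 \<and> A *v v = c *s v"

(* w^* A = c w^*; the eigenvalue c itself is not conjugated. *)
definition left_eigenvector :: "complex^'n^'n \<Rightarrow> complex \<Rightarrow> complex^'n \<Rightarrow> bool" where
  "left_eigenvector A c w \<longleftrightarrow> w \<noteq> 0 \<and> cnj_vec w v* A = c *s cnj_vec w"

(* The span and independence are over the complex numbers, hence vec.span and vec.independent
   rather than span and independent. *)
definition complex_basis :: "('n \<Rightarrow> complex^'n) \<Rightarrow> bool" where
  "complex_basis v \<longleftrightarrow> inj v \<and> vec.independent (range v) \<and> vec.span (range v) = UNIV"

definition has_partials_on ::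
  "(real \<times> real \<Rightarrow> 'a::real_normed_vector) \<Rightarrow> (real \<times> real \<Rightarrow> 'a) \<Rightarrow> (real \<times> real \<Rightarrow> 'a)
     \<Rightarrow> (real \<times> real) set \<Rightarrow> bool" where
  "has_partials_on f f1 f2 U \<longleftrightarrow>
     (\<forall>(a, b)\<in>U. ((\<lambda>x. f (x, b)) has_vector_derivative f1 (a, b)) (at a) \<and>
                 ((\<lambda>y. f (a, y)) has_vector_derivative f2 (a, b)) (at b))"

definition continuous_second_partials_on ::
  "(real \<times> real \<Rightarrow> 'a::real_normed_vector) \<Rightarrow> (real \<times> real) set \<Rightarrow> bool" where
  "continuous_second_partials_on f U \<longleftrightarrow>
     (\<exists>f1 f2 f11 f12 f21 f22.
        has_partials_on f f1 f2 U \<and> has_partials_on f1 f11 f12 U \<and> has_partials_on f2 f21 f22 U \<and>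
        continuous_on U f11 \<and> continuous_on U f12 \<and> continuous_on U f21 \<and> continuous_on U f22)"

(* R = O(alpha^3, beta^3); the bound is equivalent to O(|(alpha, beta)|^3), so mixed terms such
   as alpha^2 beta are included. *)
definition third_order :: "(real \<Rightarrow> real \<Rightarrow> 'a::real_normed_vector) \<Rightarrow> bool" where
  "third_order R \<longleftrightarrow>
     (\<lambda>(\<alpha>, \<beta>). norm (R \<alpha> \<beta>)) \<in> O[nhds (0, 0)](\<lambda>(\<alpha>, \<beta>). \<bar>\<alpha>\<bar> ^ 3 + \<bar>\<beta>\<bar> ^ 3)"

(* The scale of an eigenvector (for a multiple eigenvalue: its component in the unperturbed
   eigenspace) is not determined by the eigenvalue equation.  This fixes it: the component of x
   in the eigenspace of l i, along the eigenbasis dual to \<omega>, agrees with that of y.  If l i is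
   simple it says \<omega>_i^* x = \<omega>_i^* y. *)
definition same_eigenspace_component ::
  "('n \<Rightarrow> complex) \<Rightarrow> ('n \<Rightarrow> complex^'n) \<Rightarrow> 'n \<Rightarrow> complex^'n \<Rightarrow> complex^'n \<Rightarrow> bool" where
  "same_eigenspace_component l \<omega> i x y \<longleftrightarrow>
     (\<forall>j. l j = l i \<longrightarrow> herm_prod (\<omega> j) x = herm_prod (\<omega> j) y)"

end

theory Submission
  imports Defs
begin

text \<open>
  Everything takes place in the biorthogonal eigenbasis of \<open>A\<close>. Put \<open>\<mu> = \<lambda> - l i\<close>, let \<open>c j\<close> be the
  \<open>j\<close>-th coordinate of the perturbed eigenvector \<open>x\<close>, and let \<open>m j k = \<omega> j\<^sup>* L \<upsilon> k\<close> be the entries of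
  the perturbation, which are linear in \<open>(\<alpha>, \<beta>)\<close>. Applying \<open>\<omega> j\<^sup>*\<close> to \<open>(A + L) x = \<lambda> x\<close> turns the
  eigenvalue equation into the scalar equations
  \<open>(l i - l j + \<mu>) * c j * s j = (\<Sum>k. c k * m j k)\<close>.

  Smoothness of the eigenpair gives \<open>\<mu> = O(r)\<close> and \<open>c j = \<delta> j i + O(r)\<close>, where \<open>r\<close> is
  the norm of \<open>(\<alpha>, \<beta>)\<close> (lemma \<open>continuous_second_partials_imp_vanishes\<close>). From there on the equations improve
  themselves: every unknown on the right-hand side is multiplied by an entry \<open>m j k = O(r)\<close>,
  and moving the product \<open>\<mu> * c j\<close> to the right loses nothing, so inserting approximations with an
  error of one order gives approximations with an error of the next. One round gives \<open>\<mu>\<close> and \<open>c j\<close> up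
  to \<open>O(r\<^sup>2)\<close>, a second one up to \<open>O(r\<^sup>3)\<close> (lemmas \<open>eigenvalue_third_order\<close> and
  \<open>eigenvector_coordinate_third_order\<close>).

  When \<open>l i\<close> is a multiple eigenvalue, row \<open>i\<close> also contains the terms \<open>c k * m i k\<close> for the other
  indices \<open>k\<close> of the same eigenspace, which are absent from the formula. They vanish because of the
  continuous left eigenvector: its equation paired with \<open>\<upsilon> k\<close> expresses \<open>m i k\<close> as a sum of products
  of a function tending to \<open>0\<close> and one that is \<open>O(r)\<close>, and a linear function of size \<open>o(r)\<close> is zero
  (lemma \<open>linear_smallo_imp_zero\<close>). For the eigenvector formula the remaining freedom inside the
  eigenspace is removed by the normalization.
\<close>

section \<open>Order of vanishing at the origin\<close>

text \<open>
  Stated through norms so that one notion covers scalars, where orders add under multiplication, and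
  vectors, to which scalar bounds are carried by bounded linear maps.
\<close>

definition vanishes_to_order :: "nat \<Rightarrow> (real \<times> real \<Rightarrow> 'a::real_normed_vector) \<Rightarrow> bool" where
  "vanishes_to_order n f \<longleftrightarrow> (\<lambda>p. norm (f p)) \<in> O[nhds (0, 0)](\<lambda>p. norm p ^ n)"

lemma vanishes_to_order_zero [simp]: "vanishes_to_order n (\<lambda>p. 0)"
  by (simp add: vanishes_to_order_def)

lemma vanishes_to_order_bound:
  assumes "vanishes_to_order n g"
    and "eventually (\<lambda>p. norm (f p) \<le> K * norm (g p)) (nhds (0, 0))"
  shows "vanishes_to_order n f"
proof -
  have "(\<lambda>p. norm (f p)) \<in> O[nhds (0, 0)](\<lambda>p. norm (g p))"
    using assms(2) by (intro bigoI[where c = K]) simp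
  thus ?thesis
    using assms(1) landau_o.big_trans unfolding vanishes_to_order_def by blast
qed

lemma vanishes_to_order_cong:
  assumes "vanishes_to_order n g" and "eventually (\<lambda>p. f p = g p) (nhds (0, 0))"
  shows "vanishes_to_order n f"
  by (rule vanishes_to_order_bound[where K = 1, OF assms(1)])
     (use assms(2) in eventually_elim, simp)

lemma vanishes_to_order_add:
  assumes "vanishes_to_order n f" and "vanishes_to_order n g"
  shows "vanishes_to_order n (\<lambda>p. f p + g p)"
proof -
  have "(\<lambda>p. norm (f p) + norm (g p)) \<in> O[nhds (0, 0)](\<lambda>p. norm p ^ n)"
    using assms unfolding vanishes_to_order_def by (rule sum_in_bigo)
  hence "vanishes_to_order n (\<lambda>p. norm (f p) + norm (g p))"
    unfolding vanishes_to_order_def by simp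
  thus ?thesis
    by (rule vanishes_to_order_bound[where K = 1]) (simp add: norm_triangle_ineq)
qed

lemma vanishes_to_order_diff:
  assumes "vanishes_to_order n f" and "vanishes_to_order n g"
  shows "vanishes_to_order n (\<lambda>p. f p - g p)"
proof -
  have "vanishes_to_order n (\<lambda>p. - g p)"
    using assms(2) by (simp add: vanishes_to_order_def)
  from vanishes_to_order_add[OF assms(1) this] show ?thesis by simp
qed

lemma vanishes_to_order_sum:
  assumes "\<And>x. x \<in> S \<Longrightarrow> vanishes_to_order n (f x)"
  shows "vanishes_to_order n (\<lambda>p. \<Sum>x\<in>S. f x p)"
  using assms
  by (induction S rule: infinite_finite_induct) (auto intro: vanishes_to_order_add)

lemma vanishes_to_order_mult:
  fixes f g :: "real \<times> real \<Rightarrow> 'a::real_normed_field"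
  assumes "vanishes_to_order a f" and "vanishes_to_order b g"
  shows "vanishes_to_order (a + b) (\<lambda>p. f p * g p)"
  using landau_o.big.mult[OF assms[unfolded vanishes_to_order_def]]
  by (simp add: vanishes_to_order_def norm_mult power_add)

lemma vanishes_to_order_bounded_linear:
  assumes "bounded_linear h" and "vanishes_to_order n f"
  shows "vanishes_to_order n (\<lambda>p. h (f p))"
proof -
  obtain K where K: "\<And>x. norm (h x) \<le> norm x * K"
    using bounded_linear.bounded[OF assms(1)] by blast
  show ?thesis
    by (rule vanishes_to_order_bound[where K = K, OF assms(2)]) (simp add: K mult.commute[of K])
qed

lemma vanishes_to_order_cmult:
  fixes f :: "real \<times> real \<Rightarrow> 'a::real_normed_field"
  assumes "vanishes_to_order n f"
  shows "vanishes_to_order n (\<lambda>p. k * f p)"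
  by (rule vanishes_to_order_bounded_linear[OF bounded_linear_mult_right assms])

lemma vanishes_to_order_divide:
  fixes f :: "real \<times> real \<Rightarrow> 'a::real_normed_field"
  assumes "vanishes_to_order n f"
  shows "vanishes_to_order n (\<lambda>p. f p / k)"
  by (rule vanishes_to_order_bounded_linear[OF bounded_linear_divide assms])

lemma vanishes_to_order_linear:
  assumes "bounded_linear h"
  shows "vanishes_to_order 1 h"
proof -
  have "vanishes_to_order 1 (\<lambda>p::real \<times> real. p)"
    by (simp add: vanishes_to_order_def)
  from vanishes_to_order_bounded_linear[OF assms this] show ?thesis .
qed

lemma third_order_if_vanishes_to_order:
  assumes "vanishes_to_order 3 (\<lambda>(a, b). R a b)"
  shows "third_order R"
proof -
  have cube: "norm (a, b) ^ 3 \<le> 4 * (\<bar>a\<bar> ^ 3 + \<bar>b\<bar> ^ 3)" for a b :: real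
  proof -
    have "norm (a, b) \<le> \<bar>a\<bar> + \<bar>b\<bar>"
      using norm_Pair_le[of a b] by simp
    hence "norm (a, b) ^ 3 \<le> (\<bar>a\<bar> + \<bar>b\<bar>) ^ 3"
      by (intro power_mono) auto
    also have "\<dots> = 4 * (\<bar>a\<bar> ^ 3 + \<bar>b\<bar> ^ 3) - 3 * (\<bar>a\<bar> + \<bar>b\<bar>) * (\<bar>a\<bar> - \<bar>b\<bar>)\<^sup>2"
      by algebra
    also have "\<dots> \<le> 4 * (\<bar>a\<bar> ^ 3 + \<bar>b\<bar> ^ 3)"
      by simp
    finally show ?thesis .
  qed
  have "(\<lambda>p::real \<times> real. norm p ^ 3) \<in> O[nhds (0, 0)](\<lambda>(a, b). \<bar>a\<bar> ^ 3 + \<bar>b\<bar> ^ 3)"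
  proof (rule bigoI[where c = 4], rule always_eventually, rule allI)
    fix p :: "real \<times> real"
    show "norm (norm p ^ 3) \<le> 4 * norm (case p of (a, b) \<Rightarrow> \<bar>a\<bar> ^ 3 + \<bar>b\<bar> ^ 3)"
      using cube[of "fst p" "snd p"] by (cases p) simp
  qed
  moreover have "(\<lambda>(a, b). norm (R a b)) = (\<lambda>p. norm (case p of (a, b) \<Rightarrow> R a b))"
    by auto
  ultimately show ?thesis
    using assms landau_o.big_trans unfolding third_order_def vanishes_to_order_def by metis
qed

text \<open>
  A linear map is its own derivative at the origin, so if it is of smaller order than its argument
  then uniqueness of the derivative makes it zero.
\<close>

lemma linear_smallo_imp_zero:
  fixes h :: "real \<times> real \<Rightarrow> 'a::real_normed_vector"
  assumes h: "bounded_linear h" and small: "(\<lambda>p. norm (h p)) \<in> o[nhds (0, 0)](\<lambda>p. norm p)"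
  shows "h p = 0"
proof -
  have "((\<lambda>p. norm (h p) / norm p) \<longlongrightarrow> 0) (nhds (0, 0))"
    by (rule smalloD_tendsto[OF small])
  hence "((\<lambda>p. norm (h p) / norm p) \<longlongrightarrow> 0) (at 0)"
    by (rule filterlim_mono) (auto simp: at_within_def zero_prod_def)
  hence "(h has_derivative (\<lambda>p. 0)) (at 0)"
    by (simp add: has_derivative_at linear_simps[OF h])
  moreover have "(h has_derivative h) (at 0)"
    by (rule bounded_linear_imp_has_derivative[OF h])
  ultimately show ?thesis
    using has_derivative_unique by metis
qed

lemma tendsto_zero_mult_smallo:
  fixes f g :: "real \<times> real \<Rightarrow> 'a::real_normed_field"
  assumes f: "(f \<longlongrightarrow> 0) (nhds (0, 0))" and g: "vanishes_to_order 1 g"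
  shows "(\<lambda>p. norm (f p * g p)) \<in> o[nhds (0, 0)](\<lambda>p. norm p)"
proof -
  have "(\<lambda>p. norm (f p)) \<in> o[nhds (0, 0)](\<lambda>p. 1)"
    using tendsto_norm_zero[OF f] by (intro smalloI_tendsto) auto
  from landau_o.small_big_mult[OF this g[unfolded vanishes_to_order_def]] show ?thesis
    by (simp add: norm_mult)
qed

section \<open>First-order bounds from continuous partial derivatives\<close>

lemma vector_derivative_bound:
  fixes f :: "real \<Rightarrow> 'a::real_normed_vector"
  assumes "convex S" "x \<in> S" "y \<in> S"
    and f': "\<And>x. x \<in> S \<Longrightarrow> (f has_vector_derivative f' x) (at x within S)"
    and B: "\<And>x. x \<in> S \<Longrightarrow> norm (f' x) \<le> B"
  shows "norm (f x - f y) \<le> B * norm (x - y)"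
proof (rule differentiable_bound[where f' = "\<lambda>x h. h *\<^sub>R f' x" and S = S])
  show "onorm (\<lambda>h. h *\<^sub>R f' x) \<le> B" if "x \<in> S" for x
    using B[OF that] by (intro onorm_le) (simp add: mult.commute[of B] mult_left_mono)
qed (use assms in \<open>auto simp: has_vector_derivative_def\<close>)

text \<open>The mean value inequality, along the path \<open>(0, 0)\<close> to \<open>(0, b)\<close> to \<open>(a, b)\<close>.\<close>

text \<open>
  The mean value inequality on each leg of the path from \<open>(0, 0)\<close> over \<open>(0, b)\<close> to \<open>(a, b)\<close>. The path
  stays in every ball around the origin that contains its endpoint.
\<close>

lemma bounded_partials_imp_vanishes:
  assumes f: "has_partials_on f f1 f2 U" and U: "open U" "(0, 0) \<in> U"
    and K: "eventually (\<lambda>p. norm (f1 p) \<le> K) (nhds (0, 0))"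
           "eventually (\<lambda>p. norm (f2 p) \<le> K) (nhds (0, 0))"
  shows "vanishes_to_order 1 (\<lambda>p. f p - f (0, 0))"
proof -
  have "eventually (\<lambda>p. p \<in> U \<and> norm (f1 p) \<le> K \<and> norm (f2 p) \<le> K) (nhds (0, 0))"
    using K eventually_nhds_in_open[OF U] by eventually_elim auto
  then obtain e where e: "e > 0"
    "\<And>p. dist p (0, 0) < e \<Longrightarrow> p \<in> U \<and> norm (f1 p) \<le> K \<and> norm (f2 p) \<le> K"
    unfolding eventually_nhds_metric by blast
  have bnd: "norm (f p - f (0, 0)) \<le> (2 * K) * norm p" if p: "dist p (0, 0) < e" for p
  proof -
    obtain a b where ab: "p = (a, b)" by (cases p)
    have K0: "K \<ge> 0"
      using e(2)[OF p] norm_ge_zero order_trans by blast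
    have in_ball: "dist (x, y) (0, 0) < e" if "\<bar>x\<bar> \<le> \<bar>a\<bar>" "\<bar>y\<bar> \<le> \<bar>b\<bar>" for x y
    proof -
      have "norm (x, y) \<le> norm (a, b)"
        using that by (auto simp: norm_Pair intro!: add_mono simp flip: abs_le_square_iff)
      thus ?thesis
        using p by (simp add: ab dist_norm)
    qed
    have seg: "\<bar>x\<bar> \<le> \<bar>t\<bar>" if "x \<in> closed_segment 0 t" for x t :: real
      using segment_bound(1)[OF that] by simp
    have "norm (f (a, b) - f (0, b)) \<le> K * norm (a - 0)"
    proof (rule vector_derivative_bound[where S = "closed_segment 0 a" and f = "\<lambda>x. f (x, b)" and f' = "\<lambda>x. f1 (x, b)"])
      fix x assume "x \<in> closed_segment 0 a"
      hence x: "dist (x, b) (0, 0) < e" by (intro in_ball seg) auto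
      show "((\<lambda>x. f (x, b)) has_vector_derivative f1 (x, b)) (at x within closed_segment 0 a)"
        using f e(2)[OF x] unfolding has_partials_on_def
        by (auto intro: has_vector_derivative_at_within)
      show "norm (f1 (x, b)) \<le> K"
        using e(2)[OF x] by simp
    qed auto
    moreover have "norm (f (0, b) - f (0, 0)) \<le> K * norm (b - 0)"
    proof (rule vector_derivative_bound[where S = "closed_segment 0 b" and f = "\<lambda>y. f (0, y)" and f' = "\<lambda>y. f2 (0, y)"])
      fix y assume "y \<in> closed_segment 0 b"
      hence y: "dist (0 :: real, y) (0, 0) < e" by (intro in_ball seg) auto
      show "((\<lambda>y. f (0, y)) has_vector_derivative f2 (0, y)) (at y within closed_segment 0 b)"
        using f e(2)[OF y] unfolding has_partials_on_def
        by (auto intro: has_vector_derivative_at_within)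
      show "norm (f2 (0, y)) \<le> K"
        using e(2)[OF y] by simp
    qed auto
    moreover have "norm (f p - f (0, 0)) \<le> norm (f (a, b) - f (0, b)) + norm (f (0, b) - f (0, 0))"
      using norm_triangle_ineq[of "f (a, b) - f (0, b)" "f (0, b) - f (0, 0)"] by (simp add: ab)
    moreover have "\<bar>a\<bar> * K \<le> norm p * K" "\<bar>b\<bar> * K \<le> norm p * K"
      using norm_fst_le[of a b] norm_snd_le[of b a] K0 by (auto simp: ab intro!: mult_right_mono)
    ultimately show ?thesis
      by (simp add: algebra_simps)
  qed
  have "vanishes_to_order 1 (\<lambda>p::real \<times> real. p)"
    by (simp add: vanishes_to_order_def)
  thus ?thesis
    by (rule vanishes_to_order_bound[where K = "2 * K"])
       (use e(1) bnd in \<open>auto simp: eventually_nhds_metric\<close>)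
qed

lemma vanishes_imp_bounded:
  assumes "vanishes_to_order 1 (\<lambda>p. f p - f (0, 0))"
  shows "\<exists>K. eventually (\<lambda>p. norm (f p) \<le> K) (nhds (0, 0))"
proof -
  obtain c where c: "c > 0" "eventually (\<lambda>p. norm (f p - f (0, 0)) \<le> c * norm p) (nhds (0, 0))"
    using assms unfolding vanishes_to_order_def by (auto elim!: landau_o.bigE)
  have "eventually (\<lambda>p::real \<times> real. norm p < 1) (nhds (0, 0))"
    unfolding eventually_nhds_metric by (auto intro!: exI[of _ 1] simp: dist_norm)
  with c(2) have "eventually (\<lambda>p. norm (f p) \<le> c + norm (f (0, 0))) (nhds (0, 0))"
  proof eventually_elim
    case (elim p)
    have "c * norm p \<le> c * 1"
      using elim(2) c(1) by (intro mult_left_mono) auto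
    thus ?case
      using elim(1) norm_triangle_ineq2[of "f p" "f (0, 0)"] by linarith
  qed
  thus ?thesis by blast
qed

lemma continuous_on_tendsto_nhds:
  fixes g :: "'a::t2_space \<Rightarrow> 'b::topological_space"
  assumes "continuous_on U g" "open U" "x \<in> U"
  shows "(g \<longlongrightarrow> g x) (nhds x)"
proof -
  have "isCont g x"
    using assms continuous_on_eq_continuous_at by blast
  thus ?thesis by (simp add: continuous_within tendsto_at_iff_tendsto_nhds)
qed

lemma continuous_imp_bounded:
  fixes g :: "real \<times> real \<Rightarrow> 'a::real_normed_vector"
  assumes "continuous_on U g" and U: "open U" "(0, 0) \<in> U"
  shows "\<exists>K. eventually (\<lambda>p. norm (g p) \<le> K) (nhds (0, 0))"
proof -
  have "((\<lambda>p. norm (g p)) \<longlongrightarrow> norm (g (0, 0))) (nhds (0, 0))"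
    by (intro tendsto_norm continuous_on_tendsto_nhds[OF assms])
  hence "eventually (\<lambda>p. norm (g p) < norm (g (0, 0)) + 1) (nhds (0, 0))"
    by (rule order_tendstoD) simp
  thus ?thesis
    by (auto elim!: eventually_mono intro!: exI[of _ "norm (g (0, 0)) + 1"])
qed

lemma common_bound:
  assumes "\<exists>K. eventually (\<lambda>p. norm (g p) \<le> K) F"
    and "\<exists>K. eventually (\<lambda>p. norm (h p) \<le> K) F"
  obtains K :: real where "eventually (\<lambda>p. norm (g p) \<le> K) F" "eventually (\<lambda>p. norm (h p) \<le> K) F"
proof -
  obtain K1 K2 where "eventually (\<lambda>p. norm (g p) \<le> K1) F" "eventually (\<lambda>p. norm (h p) \<le> K2) F"
    using assms by blast
  hence "eventually (\<lambda>p. norm (g p) \<le> max K1 K2) F" "eventually (\<lambda>p. norm (h p) \<le> max K1 K2) F"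
    by (eventually_elim, simp)+
  thus ?thesis by (rule that)
qed

text \<open>
  Continuous second partials are locally bounded, hence the first partials do not vary much near the
  origin and are locally bounded as well; the previous bound, applied to them and then to \<open>f\<close>, gives
  the claim.
\<close>

lemma continuous_second_partials_imp_vanishes:
  assumes f: "continuous_second_partials_on f U" and U: "open U" "(0, 0) \<in> U"
  shows "vanishes_to_order 1 (\<lambda>p. f p - f (0, 0))"
proof -
  obtain f1 f2 f11 f12 f21 f22 where
    P: "has_partials_on f f1 f2 U" "has_partials_on f1 f11 f12 U" "has_partials_on f2 f21 f22 U"
    and C: "continuous_on U f11" "continuous_on U f12" "continuous_on U f21" "continuous_on U f22"
    using f unfolding continuous_second_partials_on_def by blast
  have *: "\<exists>K. eventually (\<lambda>p. norm (g p) \<le> K) (nhds (0, 0))"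
    if "has_partials_on g g1 g2 U" "continuous_on U g1" "continuous_on U g2" for g g1 g2
    using common_bound[OF continuous_imp_bounded[OF that(2) U] continuous_imp_bounded[OF that(3) U]]
      bounded_partials_imp_vanishes[OF that(1) U] vanishes_imp_bounded by metis
  from common_bound[OF *[OF P(2) C(1,2)] *[OF P(3) C(3,4)]] show ?thesis
    using bounded_partials_imp_vanishes[OF P(1) U] by metis
qed

section \<open>Second-order expansion of the coordinate equations\<close>

text \<open>
  The scalar form of the perturbed eigenvalue problem: \<open>c\<close> are the coordinates of the eigenvector in
  the eigenbasis, \<open>m j k\<close> is the perturbation between the \<open>j\<close>-th left and the \<open>k\<close>-th right eigenvector,
  and \<open>\<mu>\<close> is the displacement of the eigenvalue.
\<close>

locale perturbed_eigenpair_coordinates =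
  fixes l s :: "'n::finite \<Rightarrow> complex" and i :: 'n
    and m :: "'n \<Rightarrow> 'n \<Rightarrow> real \<times> real \<Rightarrow> complex"
    and c :: "'n \<Rightarrow> real \<times> real \<Rightarrow> complex" and \<mu> :: "real \<times> real \<Rightarrow> complex"
  assumes s_nonzero: "s j \<noteq> 0"
    and m_order: "vanishes_to_order 1 (m j k)"
    and mu_order: "vanishes_to_order 1 \<mu>"
    and c_order: "vanishes_to_order 1 (\<lambda>p. c j p - (if j = i then 1 else 0))"
    and coord_eq: "eventually (\<lambda>p. \<forall>j. (l i - l j + \<mu> p) * c j p * s j
                                        = (\<Sum>k\<in>UNIV. c k p * m j k p)) (nhds (0, 0))"
begin

lemma c_order_other: "j \<noteq> i \<Longrightarrow> vanishes_to_order 1 (c j)"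
  using c_order[of j] by simp

text \<open>
  The difference is \<open>\<Sum>k. (c k - \<delta> k i) * m j k\<close>, a sum of products of two first-order quantities.
\<close>

lemma row_second_order: "vanishes_to_order 2 (\<lambda>p. (\<Sum>k\<in>UNIV. c k p * m j k p) - m j i p)"
proof -
  have "vanishes_to_order (1 + 1) (\<lambda>p. \<Sum>k\<in>UNIV. (c k p - (if k = i then 1 else 0)) * m j k p)"
    by (intro vanishes_to_order_sum vanishes_to_order_mult c_order m_order)
  moreover have "(\<Sum>k\<in>UNIV. (c k p - (if k = i then 1 else 0)) * m j k p)
      = (\<Sum>k\<in>UNIV. c k p * m j k p) - m j i p" for p
    by (simp add: left_diff_distrib sum_subtractf if_distrib[of "\<lambda>x. x * _"] cong: if_cong)
  ultimately show ?thesis by (simp add: numeral_2_eq_2)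
qed

text \<open>
  Row \<open>i\<close> of the coordinate equations reads \<open>\<mu> * c i * s i = (\<Sum>k. c k * m i k)\<close>; replacing \<open>c i\<close> by \<open>1\<close>
  on the left changes it by a product of two first-order quantities.
\<close>

lemma mu_second_order: "vanishes_to_order 2 (\<lambda>p. \<mu> p * s i - m i i p)"
proof (rule vanishes_to_order_cong)
  have "vanishes_to_order (1 + 1) (\<lambda>p. \<mu> p * (c i p - 1))"
    using c_order[of i] by (intro vanishes_to_order_mult mu_order) simp
  hence "vanishes_to_order 2 (\<lambda>p. s i * (\<mu> p * (c i p - 1)))"
    using vanishes_to_order_cmult by (simp add: numeral_2_eq_2)
  thus "vanishes_to_order 2 (\<lambda>p. ((\<Sum>k\<in>UNIV. c k p * m i k p) - m i i p)
          - s i * (\<mu> p * (c i p - 1)))"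
    by (intro vanishes_to_order_diff row_second_order)
  show "eventually (\<lambda>p. \<mu> p * s i - m i i p
      = (\<Sum>k\<in>UNIV. c k p * m i k p) - m i i p - s i * (\<mu> p * (c i p - 1))) (nhds (0, 0))"
    using coord_eq
  proof eventually_elim
    case (elim p)
    from elim[rule_format, of i] show ?case by (simp add: algebra_simps)
  qed
qed

text \<open>
  Row \<open>j\<close>, solved for \<open>c j\<close> with the second-order product \<open>\<mu> * c j\<close> moved to the right-hand side.
  The quotient then has the constant denominator \<open>(l i - l j) * s j\<close> instead of one that
  involves \<open>\<mu>\<close> and would itself have to be expanded.
\<close>

lemma c_second_order:
  assumes j: "l j \<noteq> l i"
  shows "vanishes_to_order 2 (\<lambda>p. c j p - m j i p / ((l i - l j) * s j))"
proof (rule vanishes_to_order_cong)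
  have "vanishes_to_order (1 + 1) (\<lambda>p. \<mu> p * c j p)"
    using j by (intro vanishes_to_order_mult mu_order c_order_other) auto
  hence "vanishes_to_order 2 (\<lambda>p. s j * (\<mu> p * c j p))"
    using vanishes_to_order_cmult by (simp add: numeral_2_eq_2)
  thus "vanishes_to_order 2 (\<lambda>p. (((\<Sum>k\<in>UNIV. c k p * m j k p) - m j i p)
          - s j * (\<mu> p * c j p)) / ((l i - l j) * s j))"
    by (intro vanishes_to_order_divide vanishes_to_order_diff row_second_order)
  show "eventually (\<lambda>p. c j p - m j i p / ((l i - l j) * s j)
      = (((\<Sum>k\<in>UNIV. c k p * m j k p) - m j i p) - s j * (\<mu> p * c j p)) / ((l i - l j) * s j))
      (nhds (0, 0))"
    using coord_eq
  proof eventually_elim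
    case (elim p)
    have "(l i - l j) * s j \<noteq> 0" using j s_nonzero by simp
    thus ?case using elim[rule_format, of j] by (simp add: field_simps)
  qed
qed

text \<open>
  The part of a row sum that comes from outside the eigenspace: replacing \<open>c k\<close> by its first-order
  value costs a second-order error times the first-order entry \<open>m j k\<close>.
\<close>

lemma off_eigenspace_third_order:
  "vanishes_to_order 3 (\<lambda>p. (\<Sum>k | l k \<noteq> l i. c k p * m j k p)
     - (\<Sum>k | l k \<noteq> l i. m k i p / ((l i - l k) * s k) * m j k p))"
proof -
  have "vanishes_to_order (2 + 1)
      (\<lambda>p. \<Sum>k | l k \<noteq> l i. (c k p - m k i p / ((l i - l k) * s k)) * m j k p)"
    by (intro vanishes_to_order_sum vanishes_to_order_mult c_second_order m_order) auto
  thus ?thesis by (simp add: left_diff_distrib sum_subtractf)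
qed

lemma row_split:
  assumes "\<And>k. k \<noteq> i \<Longrightarrow> l k = l i \<Longrightarrow> c k p * m j k p = 0"
  shows "(\<Sum>k\<in>UNIV. c k p * m j k p) = c i p * m j i p + (\<Sum>k | l k \<noteq> l i. c k p * m j k p)"
proof -
  have "(\<Sum>k\<in>UNIV. c k p * m j k p) = (\<Sum>k\<in>insert i {k. l k \<noteq> l i}. c k p * m j k p)"
    by (rule sum.mono_neutral_right) (use assms in auto)
  thus ?thesis by simp
qed

text \<open>
  Let \<open>T = \<mu> * s i - m i i\<close>. By decoupling, row \<open>i\<close> says that \<open>c i * T\<close> is the sum of the off-eigenspace
  terms, and \<open>(c i - 1) * T\<close> is of third order because \<open>T\<close> is of second order. So \<open>T\<close> itself has the
  asserted expansion.
\<close>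

lemma eigenvalue_third_order:
  assumes decoupled: "\<And>k p. k \<noteq> i \<Longrightarrow> l k = l i \<Longrightarrow> m i k p = 0"
  shows "vanishes_to_order 3 (\<lambda>p. \<mu> p - (m i i p / s i
           + (\<Sum>k | l k \<noteq> l i. (m i k p * m k i p) / ((l i - l k) * s i * s k))))"
proof (rule vanishes_to_order_cong)
  have "vanishes_to_order (1 + 2) (\<lambda>p. (c i p - 1) * (\<mu> p * s i - m i i p))"
    using c_order[of i] by (intro vanishes_to_order_mult mu_second_order) simp
  hence "vanishes_to_order 3 (\<lambda>p. (c i p - 1) * (\<mu> p * s i - m i i p))"
    by (simp add: numeral_3_eq_3)
  with off_eigenspace_third_order[of i]
  show "vanishes_to_order 3 (\<lambda>p. (((\<Sum>k | l k \<noteq> l i. c k p * m i k p)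
     - (\<Sum>k | l k \<noteq> l i. m k i p / ((l i - l k) * s k) * m i k p))
     - (c i p - 1) * (\<mu> p * s i - m i i p)) / s i)"
    by (intro vanishes_to_order_divide vanishes_to_order_diff[of 3 "\<lambda>p. _ p - _ p"])
  show "eventually (\<lambda>p. \<mu> p - (m i i p / s i
           + (\<Sum>k | l k \<noteq> l i. (m i k p * m k i p) / ((l i - l k) * s i * s k)))
      = (((\<Sum>k | l k \<noteq> l i. c k p * m i k p)
     - (\<Sum>k | l k \<noteq> l i. m k i p / ((l i - l k) * s k) * m i k p))
     - (c i p - 1) * (\<mu> p * s i - m i i p)) / s i) (nhds (0, 0))"
    using coord_eq
  proof eventually_elim
    case (elim p)
    have S: "(\<Sum>k | l k \<noteq> l i. (m i k p * m k i p) / ((l i - l k) * s i * s k))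
        = (\<Sum>k | l k \<noteq> l i. m k i p / ((l i - l k) * s k) * m i k p) / s i"
      by (simp add: sum_divide_distrib mult_ac)
    have "\<mu> p * c i p * s i = c i p * m i i p + (\<Sum>k | l k \<noteq> l i. c k p * m i k p)"
      using elim[rule_format, of i] row_split[of p i] decoupled by simp
    thus ?case
      using s_nonzero[of i] unfolding S by (simp add: field_simps)
  qed
qed

text \<open>
  The second round of the iteration behind \<open>c_second_order\<close>. With the normalization, row \<open>j\<close> is
  \<open>c j = (m j i + (\<Sum>k. c k * m j k)) / ((l i - l j) * s j) - \<mu> * c j / (l i - l j)\<close>, where the sum runs
  outside the eigenspace. Inserting the first-order values of \<open>c k\<close>, \<open>\<mu>\<close> and \<open>c j\<close> on the right yields
  the double sum and the final correction term.
\<close>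

lemma eigenvector_coordinate_third_order:
  assumes normalized: "eventually (\<lambda>p. c i p = 1 \<and> (\<forall>k. k \<noteq> i \<longrightarrow> l k = l i \<longrightarrow> c k p = 0)) (nhds (0, 0))"
    and j: "l j \<noteq> l i"
  shows "vanishes_to_order 3 (\<lambda>p. c j p - (m j i p / ((l i - l j) * s j)
           + (\<Sum>k | l k \<noteq> l i. (m j k p * m k i p) / ((l i - l k) * (l i - l j) * s k * s j))
           - (m j i p * m i i p) / ((l i - l j)\<^sup>2 * s i * s j)))"
proof (rule vanishes_to_order_cong)
  define D where "D = l i - l j"
  have D: "D \<noteq> 0" using j by (simp add: D_def)
  \<comment> \<open>Together these replace \<open>\<mu> * c j\<close> by \<open>(m i i / s i) * (m j i / (D * s j))\<close>, one factor at a time.\<close>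
  have "vanishes_to_order (2 + 1) (\<lambda>p. (\<mu> p * s i - m i i p) * c j p)"
    using j by (intro vanishes_to_order_mult mu_second_order c_order_other) auto
  moreover have "vanishes_to_order (1 + 2) (\<lambda>p. m i i p * (c j p - m j i p / (D * s j)))"
    unfolding D_def using j by (intro vanishes_to_order_mult m_order c_second_order)
  ultimately have "vanishes_to_order 3 (\<lambda>p. (\<mu> p * s i - m i i p) * c j p / s i)"
    "vanishes_to_order 3 (\<lambda>p. m i i p * (c j p - m j i p / (D * s j)) / s i)"
    by (auto intro!: vanishes_to_order_divide simp: numeral_3_eq_3)
  with off_eigenspace_third_order[of j]
  show "vanishes_to_order 3 (\<lambda>p. ((\<Sum>k | l k \<noteq> l i. c k p * m j k p)
     - (\<Sum>k | l k \<noteq> l i. m k i p / ((l i - l k) * s k) * m j k p)) / (D * s j)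
     - ((\<mu> p * s i - m i i p) * c j p / s i + m i i p * (c j p - m j i p / (D * s j)) / s i) / D)"
    by (intro vanishes_to_order_diff[of 3 "\<lambda>p. _ p / _"] vanishes_to_order_divide[of 3 "\<lambda>p. _ p - _ p"]
        vanishes_to_order_divide[of 3 "\<lambda>p. _ p + _ p"] vanishes_to_order_add)
  show "eventually (\<lambda>p. c j p - (m j i p / ((l i - l j) * s j)
           + (\<Sum>k | l k \<noteq> l i. (m j k p * m k i p) / ((l i - l k) * (l i - l j) * s k * s j))
           - (m j i p * m i i p) / ((l i - l j)\<^sup>2 * s i * s j))
      = ((\<Sum>k | l k \<noteq> l i. c k p * m j k p)
     - (\<Sum>k | l k \<noteq> l i. m k i p / ((l i - l k) * s k) * m j k p)) / (D * s j)
     - ((\<mu> p * s i - m i i p) * c j p / s i + m i i p * (c j p - m j i p / (D * s j)) / s i) / D)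
     (nhds (0, 0))"
    using coord_eq normalized
  proof eventually_elim
    case (elim p)
    define P where "P = (\<Sum>k | l k \<noteq> l i. m k i p / ((l i - l k) * s k) * m j k p)"
    have S: "(\<Sum>k | l k \<noteq> l i. (m j k p * m k i p) / ((l i - l k) * (l i - l j) * s k * s j))
        = P / (D * s j)"
      by (simp add: sum_divide_distrib mult_ac D_def P_def)
    have eq: "(D + \<mu> p) * c j p * s j = m j i p + (\<Sum>k | l k \<noteq> l i. c k p * m j k p)"
      using elim row_split[of p j] by (simp add: D_def)
    have cj: "c j p = (m j i p + (\<Sum>k | l k \<noteq> l i. c k p * m j k p)) / (D * s j) - \<mu> p * c j p / D"
    proof -
      have "c j p * (D * s j) = m j i p + (\<Sum>k | l k \<noteq> l i. c k p * m j k p) - \<mu> p * c j p * s j"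
        using eq by (simp add: algebra_simps)
      hence "c j p = (m j i p + (\<Sum>k | l k \<noteq> l i. c k p * m j k p) - \<mu> p * c j p * s j) / (D * s j)"
        using D s_nonzero[of j] by (simp add: eq_divide_eq)
      thus ?thesis using s_nonzero[of j] by (simp add: diff_divide_distrib)
    qed
    show ?case
      unfolding S unfolding D_def[symmetric] P_def[symmetric]
      using D s_nonzero[of j] s_nonzero[of i]
      by (subst (1) cj) (simp add: diff_divide_distrib add_divide_distrib power2_eq_square algebra_simps)
  qed
qed

end

section \<open>Coordinates with respect to a biorthogonal eigenbasis\<close>

lemma herm_prod_add_right: "herm_prod w (x + y) = herm_prod w x + herm_prod w y"
  by (simp add: herm_prod_def distrib_left sum.distrib)

lemma herm_prod_smult_right: "herm_prod w (a *s x) = a * herm_prod w x"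
  by (simp add: herm_prod_def sum_distrib_left mult_ac)

lemma herm_prod_diff_right: "herm_prod w (x - y) = herm_prod w x - herm_prod w y"
  by (simp add: herm_prod_def right_diff_distrib sum_subtractf)

lemma herm_prod_scaleR_right: "herm_prod w (r *\<^sub>R x) = r *\<^sub>R herm_prod w x"
  by (simp add: herm_prod_def scaleR_sum_right)

lemma herm_prod_zero_right [simp]: "herm_prod w 0 = 0"
  by (simp add: herm_prod_def)

lemma herm_prod_sum_right: "herm_prod w (\<Sum>k\<in>S. f k) = (\<Sum>k\<in>S. herm_prod w (f k))"
  by (induction S rule: infinite_finite_induct) (auto simp: herm_prod_add_right)

lemma bounded_linear_herm_prod: "bounded_linear (herm_prod w)"
  by (intro linear_conv_bounded_linear[THEN iffD1] linearI)
     (simp_all add: herm_prod_add_right herm_prod_scaleR_right)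

lemma herm_prod_eq_zero_imp:
  assumes "\<And>x. herm_prod w x = 0"
  shows "w = 0"
proof (rule vec_eq_iff[THEN iffD2], rule allI)
  fix k
  have "herm_prod w (axis k 1) = cnj (w $ k)"
    by (simp add: herm_prod_def axis_def if_distrib[of "\<lambda>x. _ * x"] cong: if_cong)
  thus "w $ k = 0 $ k" using assms by simp
qed

text \<open>
  The eigenvalue comes out unconjugated, since \<open>left_eigenvector\<close> refers to \<open>w\<^sup>* A = a w\<^sup>*\<close>.
\<close>

lemma left_eigenvector_herm_prod:
  assumes "left_eigenvector A a w"
  shows "herm_prod w (A *v x) = a * herm_prod w x"
proof -
  have col: "(\<Sum>j\<in>UNIV. cnj (w $ j) * A $ j $ k) = a * cnj (w $ k)" for k
  proof -
    have "(cnj_vec w v* A) $ k = (a *s cnj_vec w) $ k"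
      using assms by (simp add: left_eigenvector_def)
    thus ?thesis by (simp add: vector_matrix_mult_def cnj_vec_def mult_ac)
  qed
  have "herm_prod w (A *v x) = (\<Sum>j\<in>UNIV. \<Sum>k\<in>UNIV. cnj (w $ j) * A $ j $ k * x $ k)"
    by (simp add: herm_prod_def matrix_vector_mult_def sum_distrib_left mult_ac)
  also have "\<dots> = (\<Sum>k\<in>UNIV. (\<Sum>j\<in>UNIV. cnj (w $ j) * A $ j $ k) * x $ k)"
    by (subst sum.swap) (simp add: sum_distrib_right)
  also have "\<dots> = a * herm_prod w x"
    by (simp add: col herm_prod_def sum_distrib_left mult_ac)
  finally show ?thesis .
qed

text \<open>
  If \<open>\<omega> j\<^sup>* \<upsilon> j\<close> were zero, then \<open>\<omega> j\<close> would annihilate the whole basis and hence be zero.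
\<close>

lemma biorthogonal_basis_expansion:
  fixes \<upsilon> \<omega> :: "'n::finite \<Rightarrow> complex^'n"
  assumes basis: "complex_basis \<upsilon>" and orth: "\<And>j k. j \<noteq> k \<Longrightarrow> herm_prod (\<omega> j) (\<upsilon> k) = 0"
    and nz: "\<And>j. \<omega> j \<noteq> 0"
  shows "herm_prod (\<omega> j) (\<upsilon> j) \<noteq> 0"
    and "x = (\<Sum>k\<in>UNIV. (herm_prod (\<omega> k) x / herm_prod (\<omega> k) (\<upsilon> k)) *s \<upsilon> k)"
proof -
  have ex: "\<exists>u. x = (\<Sum>k\<in>UNIV. u k *s \<upsilon> k)" for x
  proof -
    have "x \<in> vec.span (range \<upsilon>)" using basis by (simp add: complex_basis_def)
    then obtain u where "x = (\<Sum>v\<in>range \<upsilon>. u v *s v)"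
      using vec.span_finite[of "range \<upsilon>"] by auto
    hence "x = (\<Sum>k\<in>UNIV. u (\<upsilon> k) *s \<upsilon> k)"
      using basis by (simp add: sum.reindex complex_basis_def)
    thus ?thesis by (rule exI[of _ "\<lambda>k. u (\<upsilon> k)"])
  qed
  have coord: "herm_prod (\<omega> j) (\<Sum>k\<in>UNIV. u k *s \<upsilon> k) = u j * herm_prod (\<omega> j) (\<upsilon> j)" for u j
  proof -
    have "(\<Sum>k\<in>UNIV. u k * herm_prod (\<omega> j) (\<upsilon> k)) = (\<Sum>k\<in>{j}. u k * herm_prod (\<omega> j) (\<upsilon> k))"
      by (rule sum.mono_neutral_right) (auto simp: orth)
    thus ?thesis by (simp add: herm_prod_sum_right herm_prod_smult_right)
  qed
  show s: "herm_prod (\<omega> j) (\<upsilon> j) \<noteq> 0" for j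
  proof
    assume "herm_prod (\<omega> j) (\<upsilon> j) = 0"
    hence "herm_prod (\<omega> j) x = 0" for x
      using ex[of x] coord[of j] by auto
    with nz herm_prod_eq_zero_imp show False by blast
  qed
  obtain u where u: "x = (\<Sum>k\<in>UNIV. u k *s \<upsilon> k)" using ex by blast
  have "herm_prod (\<omega> k) x / herm_prod (\<omega> k) (\<upsilon> k) = u k" for k
    unfolding u coord using s by simp
  thus "x = (\<Sum>k\<in>UNIV. (herm_prod (\<omega> k) x / herm_prod (\<omega> k) (\<upsilon> k)) *s \<upsilon> k)"
    using u by simp
qed

lemma matrix_vector_mult_smult: "(M :: complex^'n^'m) *v (a *s x) = a *s (M *v x)"
  by (simp add: vec_eq_iff matrix_vector_mult_def sum_distrib_left mult_ac)

lemma matrix_vector_mult_sum_right: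
  "(M :: complex^'n^'m) *v (\<Sum>k\<in>S. f k) = (\<Sum>k\<in>S. M *v f k)"
  by (induction S rule: infinite_finite_induct) (auto simp: matrix_vector_right_distrib)

lemma herm_prod_matrix_sum:
  "herm_prod w (M *v (\<Sum>k\<in>S. a k *s f k)) = (\<Sum>k\<in>S. a k * herm_prod w (M *v f k))"
  by (simp add: matrix_vector_mult_sum_right herm_prod_sum_right matrix_vector_mult_smult
      herm_prod_smult_right)

lemma matrix_scaleR_vector: "(r *\<^sub>R (M :: complex^'n^'m)) *v x = r *\<^sub>R (M *v x)"
  by (simp add: vec_eq_iff matrix_vector_mult_def scaleR_sum_right)

lemma bounded_linear_pert_entry:
  "bounded_linear (\<lambda>p. herm_prod w (pert E (fst p) (snd p) *v x))"
proof -
  have "herm_prod w (pert E a b *v x) = a *\<^sub>R herm_prod w (herm_part (complex_mat E) *v x)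
      + b *\<^sub>R herm_prod w (skew_part (complex_mat E) *v x)" for a b
    by (simp add: pert_def matrix_vector_mult_add_rdistrib herm_prod_add_right
        matrix_scaleR_vector herm_prod_scaleR_right)
  thus ?thesis
    by (auto intro!: bounded_linear_add bounded_linear_compose[OF bounded_linear_scaleR_left]
        bounded_linear_fst bounded_linear_snd)
qed

lemma bounded_linear_smult_left: "bounded_linear (\<lambda>a. a *s (v :: complex^'n))"
  by (intro linear_conv_bounded_linear[THEN iffD1] linearI)
     (simp_all add: vec_eq_iff distrib_right)

theorem theorem2:
  fixes A :: "complex^'n^'n" and E :: "real^'n^'n"
    and l :: "'n \<Rightarrow> complex" and \<upsilon> \<omega> :: "'n \<Rightarrow> complex^'n" and i :: 'n
    and U :: "(real \<times> real) set"
    and lam :: "real \<times> real \<Rightarrow> complex" and vv ww :: "real \<times> real \<Rightarrow> complex^'n"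
    and s :: "'n \<Rightarrow> complex" and L :: "real \<Rightarrow> real \<Rightarrow> complex^'n^'n"
  assumes "diagonalizable A"
    and "\<And>j. right_eigenvector A (l j) (\<upsilon> j)"
    and "\<And>j. left_eigenvector A (l j) (\<omega> j)"
    and "complex_basis \<upsilon>"
    and "\<And>j k. j \<noteq> k \<Longrightarrow> herm_prod (\<omega> j) (\<upsilon> k) = 0"
    and s_def: "\<And>j. s j = herm_prod (\<omega> j) (\<upsilon> j)"
    and L_def: "\<And>\<alpha> \<beta>. L \<alpha> \<beta> = pert E \<alpha> \<beta>"
    and "open U" and "(0, 0) \<in> U"
    and "\<And>\<alpha> \<beta>. (\<alpha>, \<beta>) \<in> U \<Longrightarrow> right_eigenvector (A + L \<alpha> \<beta>) (lam (\<alpha>, \<beta>)) (vv (\<alpha>, \<beta>))"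
    and "\<And>\<alpha> \<beta>. (\<alpha>, \<beta>) \<in> U \<Longrightarrow> left_eigenvector (A + L \<alpha> \<beta>) (lam (\<alpha>, \<beta>)) (ww (\<alpha>, \<beta>))"
    and "continuous_on U lam" and "continuous_on U vv" and "continuous_on U ww"
    and "lam (0, 0) = l i" and "vv (0, 0) = \<upsilon> i" and "ww (0, 0) = \<omega> i"
    and "continuous_second_partials_on lam U" and "continuous_second_partials_on vv U"
  shows "third_order (\<lambda>\<alpha> \<beta>. lam (\<alpha>, \<beta>) -
           (l i + herm_prod (\<omega> i) (L \<alpha> \<beta> *v \<upsilon> i) / s i
            + (\<Sum>k | l k \<noteq> l i.
                 (herm_prod (\<omega> i) (L \<alpha> \<beta> *v \<upsilon> k) * herm_prod (\<omega> k) (L \<alpha> \<beta> *v \<upsilon> i))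
                 / ((l i - l k) * s i * s k)))) \<and>
         ((\<forall>(\<alpha>, \<beta>)\<in>U. same_eigenspace_component l \<omega> i (vv (\<alpha>, \<beta>)) (\<upsilon> i)) \<longrightarrow>
          third_order (\<lambda>\<alpha> \<beta>. vv (\<alpha>, \<beta>) -
           (\<upsilon> i
            + (\<Sum>k | l k \<noteq> l i.
                 (herm_prod (\<omega> k) (L \<alpha> \<beta> *v \<upsilon> i) / ((l i - l k) * s k)) *s \<upsilon> k)
            + (\<Sum>j | l j \<noteq> l i. \<Sum>k | l k \<noteq> l i.
                 ((herm_prod (\<omega> j) (L \<alpha> \<beta> *v \<upsilon> k) * herm_prod (\<omega> k) (L \<alpha> \<beta> *v \<upsilon> i))
                  / ((l i - l k) * (l i - l j) * s k * s j)) *s \<upsilon> j)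
            - (\<Sum>j | l j \<noteq> l i.
                 ((herm_prod (\<omega> j) (L \<alpha> \<beta> *v \<upsilon> i) * herm_prod (\<omega> i) (L \<alpha> \<beta> *v \<upsilon> i))
                  / ((l i - l j)\<^sup>2 * s i * s j)) *s \<upsilon> j))))"
proof (intro conjI impI)
  note right = assms(2) and left = assms(3) and basis = assms(4) and orth = assms(5)
    and U = assms(8,9) and right_p = assms(10) and left_p = assms(11)
    and ww_cont = assms(14) and lam0 = assms(15) and vv0 = assms(16) and ww0 = assms(17)
    and lam_C2 = assms(18) and vv_C2 = assms(19)
  define m where "m j k p = herm_prod (\<omega> j) (pert E (fst p) (snd p) *v \<upsilon> k)" for j k p
  define \<mu> where "\<mu> p = lam p - l i" for p
  define c where "c j p = herm_prod (\<omega> j) (vv p) / s j" for j p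
  have inU: "eventually (\<lambda>p. p \<in> U) (nhds (0, 0))"
    by (rule eventually_nhds_in_open[OF U])
  have nz: "\<omega> j \<noteq> 0" for j
    using left[of j] by (simp add: left_eigenvector_def)
  have s_nz: "s j \<noteq> 0" for j
    using biorthogonal_basis_expansion(1)[OF basis orth nz] by (simp add: s_def)
  have expand: "x = (\<Sum>k\<in>UNIV. (herm_prod (\<omega> k) x / s k) *s \<upsilon> k)" for x
    using biorthogonal_basis_expansion(2)[OF basis orth nz] by (simp add: s_def)
  have m_linear: "bounded_linear (m j k)" for j k
    using bounded_linear_pert_entry[of "\<omega> j" E "\<upsilon> k"] unfolding m_def[abs_def] .
  have m_row: "herm_prod (\<omega> j) (pert E (fst p) (snd p) *v vv p) = (\<Sum>k\<in>UNIV. c k p * m j k p)" for j p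
    by (subst expand[of "vv p"]) (simp only: herm_prod_matrix_sum c_def m_def)
  have basis_coord: "herm_prod (\<omega> j) (\<upsilon> i) / s j = (if j = i then 1 else 0)" for j
    using orth[of j i] s_nz[of i] s_def[of i] by auto
  have coord_eq: "(l i - l j + \<mu> p) * c j p * s j = (\<Sum>k\<in>UNIV. c k p * m j k p)" if "p \<in> U" for p j
  proof -
    let ?L = "pert E (fst p) (snd p)"
    have "(A + ?L) *v vv p = lam p *s vv p"
      using right_p[of "fst p" "snd p"] that by (simp add: right_eigenvector_def L_def)
    hence "herm_prod (\<omega> j) (A *v vv p) + herm_prod (\<omega> j) (?L *v vv p) = lam p * herm_prod (\<omega> j) (vv p)"
      by (metis matrix_vector_mult_add_rdistrib herm_prod_add_right herm_prod_smult_right)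
    hence "lam p * herm_prod (\<omega> j) (vv p) - l j * herm_prod (\<omega> j) (vv p) = (\<Sum>k\<in>UNIV. c k p * m j k p)"
      by (simp add: left_eigenvector_herm_prod[OF left] m_row algebra_simps)
    thus ?thesis
      using s_nz[of j] by (simp add: c_def \<mu>_def algebra_simps)
  qed
  have mu1: "vanishes_to_order 1 \<mu>"
    using continuous_second_partials_imp_vanishes[OF lam_C2 U] by (simp add: \<mu>_def[abs_def] lam0)
  have c1: "vanishes_to_order 1 (\<lambda>p. c j p - (if j = i then 1 else 0))" for j
  proof -
    have "vanishes_to_order 1 (\<lambda>p. herm_prod (\<omega> j) (vv p - vv (0, 0)) / s j)"
      by (intro vanishes_to_order_divide vanishes_to_order_bounded_linear[OF bounded_linear_herm_prod]
          continuous_second_partials_imp_vanishes[OF vv_C2 U])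
    thus ?thesis
      by (simp add: herm_prod_diff_right diff_divide_distrib vv0 basis_coord c_def)
  qed
  interpret perturbed_eigenpair_coordinates l s i m c \<mu>
  proof
    show "eventually (\<lambda>p. \<forall>j. (l i - l j + \<mu> p) * c j p * s j
        = (\<Sum>k\<in>UNIV. c k p * m j k p)) (nhds (0, 0))"
      using inU by eventually_elim (use coord_eq in auto)
  qed (use s_nz vanishes_to_order_linear[OF m_linear] mu1 c1 in auto)
  have m_eq: "herm_prod (\<omega> j) (L a b *v \<upsilon> k) = m j k (a, b)" for j k a b
    by (simp add: L_def m_def)

  \<comment> \<open>The perturbation does not couple \<open>i\<close> to the rest of its eigenspace: a consequence of a
      left eigenvector converging to \<open>\<omega> i\<close>.\<close>
  have decoupled: "m i k p = 0" if k: "k \<noteq> i" "l k = l i" for k p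
  proof (rule linear_smallo_imp_zero[OF m_linear])
    define d where "d j p = herm_prod (ww p) (\<upsilon> j)" for j p
    have d_lim: "(d j \<longlongrightarrow> herm_prod (\<omega> i) (\<upsilon> j)) (nhds (0, 0))" for j
      unfolding d_def[abs_def] herm_prod_def
      using continuous_on_tendsto_nhds[OF ww_cont U] unfolding ww0
      by (intro tendsto_sum tendsto_mult tendsto_const tendsto_cnj tendsto_vec_nth)
    have dk: "(d k \<longlongrightarrow> 0) (nhds (0, 0))"
      using d_lim[of k] orth[of i k] k(1) by simp
    have dj: "((\<lambda>p. d j p / s j - (if j = i then 1 else 0)) \<longlongrightarrow> 0) (nhds (0, 0))" for j
    proof -
      have "((\<lambda>p. d j p / s j - (if j = i then 1 else 0)) \<longlongrightarrow>
          herm_prod (\<omega> i) (\<upsilon> j) / s j - (if j = i then 1 else 0)) (nhds (0, 0))"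
        by (intro tendsto_intros d_lim s_nz)
      moreover have "herm_prod (\<omega> i) (\<upsilon> j) / s j - (if j = i then 1 else 0) = 0"
        using orth[of i j] s_nz[of i] s_def[of i] by auto
      ultimately show ?thesis by simp
    qed
    \<comment> \<open>The coordinate equation of the left eigenvector in column \<open>k\<close>, with \<open>m i k\<close> isolated; the
        factor \<open>l i - l k\<close> is zero.\<close>
    have eq: "m i k p = d k p * \<mu> p - (\<Sum>j\<in>UNIV. (d j p / s j - (if j = i then 1 else 0)) * m j k p)"
      if "p \<in> U" for p
    proof -
      let ?L = "pert E (fst p) (snd p)"
      have "left_eigenvector (A + ?L) (lam p) (ww p)"
        using left_p[of "fst p" "snd p"] that by (simp add: L_def)
      hence "herm_prod (ww p) ((A + ?L) *v \<upsilon> k) = lam p * d k p"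
        by (simp add: left_eigenvector_herm_prod d_def)
      moreover have "A *v \<upsilon> k = l k *s \<upsilon> k"
        using right[of k] by (simp add: right_eigenvector_def)
      ultimately have "l k * d k p + herm_prod (ww p) (?L *v \<upsilon> k) = lam p * d k p"
        by (simp add: matrix_vector_mult_add_rdistrib herm_prod_add_right herm_prod_smult_right d_def)
      moreover have "herm_prod (ww p) (?L *v \<upsilon> k) = (\<Sum>j\<in>UNIV. d j p / s j * m j k p)"
        by (subst expand[of "?L *v \<upsilon> k"])
           (simp add: herm_prod_sum_right herm_prod_smult_right d_def m_def mult_ac)
      ultimately have "d k p * \<mu> p = (\<Sum>j\<in>UNIV. d j p / s j * m j k p)"
        by (simp add: k(2) \<mu>_def algebra_simps)
      thus ?thesis
        by (simp add: left_diff_distrib sum_subtractf if_distrib[of "\<lambda>x. x * _"] cong: if_cong)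
    qed
    let ?r = "\<lambda>p. norm (d k p * \<mu> p)
        + (\<Sum>j\<in>UNIV. norm ((d j p / s j - (if j = i then 1 else 0)) * m j k p))"
    have "?r \<in> o[nhds (0, 0)](\<lambda>p. norm p)"
      by (intro sum_in_smallo big_sum_in_smallo tendsto_zero_mult_smallo dk dj mu_order m_order)
    moreover have "(\<lambda>p. norm (m i k p)) \<in> O[nhds (0, 0)](?r)"
    proof (rule bigoI[where c = 1])
      show "eventually (\<lambda>p. norm (norm (m i k p)) \<le> 1 * norm (?r p)) (nhds (0, 0))"
        using inU
      proof eventually_elim
        case (elim p)
        have "norm (m i k p) \<le> ?r p"
          unfolding eq[OF elim] by (intro order_trans[OF norm_triangle_ineq4] add_mono norm_sum order_refl)
        thus ?case by simp
      qed
    qed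
    ultimately show "(\<lambda>p. norm (m i k p)) \<in> o[nhds (0, 0)](\<lambda>p. norm p)"
      using landau_o.big_small_trans by blast
  qed

  show "third_order (\<lambda>\<alpha> \<beta>. lam (\<alpha>, \<beta>) -
           (l i + herm_prod (\<omega> i) (L \<alpha> \<beta> *v \<upsilon> i) / s i
            + (\<Sum>k | l k \<noteq> l i.
                 (herm_prod (\<omega> i) (L \<alpha> \<beta> *v \<upsilon> k) * herm_prod (\<omega> k) (L \<alpha> \<beta> *v \<upsilon> i))
                 / ((l i - l k) * s i * s k))))"
    using eigenvalue_third_order[OF decoupled]
    by (intro third_order_if_vanishes_to_order) (simp add: m_eq \<mu>_def case_prod_beta' algebra_simps)

  assume norm: "\<forall>(\<alpha>, \<beta>)\<in>U. same_eigenspace_component l \<omega> i (vv (\<alpha>, \<beta>)) (\<upsilon> i)"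
  define t where "t j p = m j i p / ((l i - l j) * s j)
           + (\<Sum>k | l k \<noteq> l i. (m j k p * m k i p) / ((l i - l k) * (l i - l j) * s k * s j))
           - (m j i p * m i i p) / ((l i - l j)\<^sup>2 * s i * s j)" for j p
  have c_norm: "c j p = (if j = i then 1 else 0)" if "p \<in> U" "l j = l i" for j p
    using norm that basis_coord[of j] by (auto simp: same_eigenspace_component_def c_def)
  have "eventually (\<lambda>p. c i p = 1 \<and> (\<forall>k. k \<noteq> i \<longrightarrow> l k = l i \<longrightarrow> c k p = 0)) (nhds (0, 0))"
    using inU by eventually_elim (simp add: c_norm)
  from eigenvector_coordinate_third_order[OF this]
  have coord: "vanishes_to_order 3 (\<lambda>p. c j p - t j p)" if "l j \<noteq> l i" for j
    using that unfolding t_def by blast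
  have vec: "vanishes_to_order 3 (\<lambda>p. vv p - (\<upsilon> i + (\<Sum>j | l j \<noteq> l i. t j p *s \<upsilon> j)))"
  proof (rule vanishes_to_order_cong)
    show "vanishes_to_order 3 (\<lambda>p. \<Sum>j | l j \<noteq> l i. (c j p - t j p) *s \<upsilon> j)"
      by (intro vanishes_to_order_sum vanishes_to_order_bounded_linear[OF bounded_linear_smult_left] coord) auto
    show "eventually (\<lambda>p. vv p - (\<upsilon> i + (\<Sum>j | l j \<noteq> l i. t j p *s \<upsilon> j))
        = (\<Sum>j | l j \<noteq> l i. (c j p - t j p) *s \<upsilon> j)) (nhds (0, 0))"
      using inU
    proof eventually_elim
      case (elim p)
      have "vv p = (\<Sum>j\<in>UNIV. c j p *s \<upsilon> j)"
        using expand[of "vv p"] by (simp add: c_def)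
      also have "\<dots> = (\<Sum>j\<in>insert i {j. l j \<noteq> l i}. c j p *s \<upsilon> j)"
        by (rule sum.mono_neutral_right) (auto simp: c_norm[OF elim])
      finally have "vv p = \<upsilon> i + (\<Sum>j | l j \<noteq> l i. c j p *s \<upsilon> j)"
        by (simp add: c_norm[OF elim])
      thus ?case
        by (simp add: vec.scale_left_diff_distrib sum_subtractf)
    qed
  qed
  have t_sum: "(\<Sum>j | l j \<noteq> l i. t j p *s \<upsilon> j) =
      (\<Sum>k | l k \<noteq> l i. (m k i p / ((l i - l k) * s k)) *s \<upsilon> k)
      + (\<Sum>j | l j \<noteq> l i. \<Sum>k | l k \<noteq> l i.
           ((m j k p * m k i p) / ((l i - l k) * (l i - l j) * s k * s j)) *s \<upsilon> j)
      - (\<Sum>j | l j \<noteq> l i. ((m j i p * m i i p) / ((l i - l j)\<^sup>2 * s i * s j)) *s \<upsilon> j)" for p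
    unfolding t_def
    by (simp add: vec.scale_left_diff_distrib vec.scale_left_distrib sum_subtractf sum.distrib
        vec.scale_sum_left)
  show "third_order (\<lambda>\<alpha> \<beta>. vv (\<alpha>, \<beta>) -
           (\<upsilon> i
            + (\<Sum>k | l k \<noteq> l i.
                 (herm_prod (\<omega> k) (L \<alpha> \<beta> *v \<upsilon> i) / ((l i - l k) * s k)) *s \<upsilon> k)
            + (\<Sum>j | l j \<noteq> l i. \<Sum>k | l k \<noteq> l i.
                 ((herm_prod (\<omega> j) (L \<alpha> \<beta> *v \<upsilon> k) * herm_prod (\<omega> k) (L \<alpha> \<beta> *v \<upsilon> i))
                  / ((l i - l k) * (l i - l j) * s k * s j)) *s \<upsilon> j)
            - (\<Sum>j | l j \<noteq> l i.
                 ((herm_prod (\<omega> j) (L \<alpha> \<beta> *v \<upsilon> i) * herm_prod (\<omega> i) (L \<alpha> \<beta> *v \<upsilon> i))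
                  / ((l i - l j)\<^sup>2 * s i * s j)) *s \<upsilon> j)))"
    using vec unfolding t_sum
    by (intro third_order_if_vanishes_to_order)
       (simp only: m_eq case_prod_beta' prod.collapse add.assoc add_diff_eq)
qed

end
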